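(* Let $Q_1,Q_2$ be probability distributions on $\mathbb{R}$. Then $Q_1\le_{\rm lr}Q_2$ if and only if $\mathrm{ROC}(Q_1,Q_2)$ is concave in the following sense: if $(a_1,a_2)$, $(b_1,b_2)$ and $(c_1,c_2)$ are three different points in $\mathrm{ROC}(Q_1,Q_2)$ with $a_1\le b_1\le c_1$ and $a_2\le b_2\le c_2$, then \[ \frac{b_2-a_2}{b_1-a_1}\ \ge\ \frac{c_2-b_2}{c_1-b_1}. \]
   Context: Likelihood ratio order: $Q_1\le_{\rm lr}Q_2$ means that there exist a $\sigma$-finite measure $\mu$ on $\mathbb{R}$ and densities $g_j=\mathrm{d}Q_j/\mathrm{d}\mu:\mathbb{R}\to[0,\infty)$ ($j=1,2$) such that $g_2/g_1$ (with values in $[0,\infty]$) is non-decreasing on $\{g_1+g_2>0\}$. ROC curve: $\mathrm{ROC}(Q_1,Q_2):=\{(Q_1(H),Q_2(H)):H\in\mathcal{H}\}$, where $\mathcal{H}:=\{(y,\infty):y\in\mathbb{R}\}\cup\{[y,\infty):y\in\mathbb{R}\}\cup\{\emptyset,\mathbb{R}\}$. Fractions of nonnegative numbers (numerator and denominator not both zero) are taken in $[0,\infty]$, with $c/0:=\infty$ for $c>0$. "Three different points" means pairwise distinct. *)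

theory Defs
  imports "HOL-Probability.Probability"
begin

text \<open>
  Ratios are taken in \<^typ>\<open>ennreal\<close>, where \<open>c / 0 = \<infinity>\<close> for \<open>c > 0\<close>, whereas division on
  \<^typ>\<open>real\<close> would give \<open>c / 0 = 0\<close>.  The remaining library convention \<open>0 / 0 = 0\<close> is never
  used: on the set where \<open>g1 + g2 > 0\<close>, and for the increments between distinct points,
  numerator and denominator do not vanish simultaneously.
\<close>

definition lr_le :: "real measure \<Rightarrow> real measure \<Rightarrow> bool"  (infix "\<le>\<^sub>l\<^sub>r" 50) where
  "Q1 \<le>\<^sub>l\<^sub>r Q2 \<longleftrightarrow>
    (\<exists>(\<mu> :: real measure) (g1 :: real \<Rightarrow> real) (g2 :: real \<Rightarrow> real).
        sigma_finite_measure \<mu> \<and> sets \<mu> = sets borel \<and>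
        g1 \<in> borel_measurable borel \<and> g2 \<in> borel_measurable borel \<and>
        (\<forall>x. 0 \<le> g1 x) \<and> (\<forall>x. 0 \<le> g2 x) \<and>
        Q1 = density \<mu> (\<lambda>x. ennreal (g1 x)) \<and>
        Q2 = density \<mu> (\<lambda>x. ennreal (g2 x)) \<and>
        mono_on {x. g1 x + g2 x > 0} (\<lambda>x. ennreal (g2 x) / ennreal (g1 x)))"

definition upper_halflines :: "real set set" where
  "upper_halflines = {{y<..} | y. True} \<union> {{y..} | y. True} \<union> {{}, UNIV}"

definition ROC :: "real measure \<Rightarrow> real measure \<Rightarrow> (real \<times> real) set" where
  "ROC Q1 Q2 = {(measure Q1 H, measure Q2 H) | H. H \<in> upper_halflines}"

text \<open>
  Under the ordering hypotheses below all differences are nonnegative, so the embedding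
  \<^const>\<open>ennreal\<close>, which truncates negative reals to \<open>0\<close>, preserves them.
\<close>

definition ROC_concave :: "(real \<times> real) set \<Rightarrow> bool" where
  "ROC_concave R \<longleftrightarrow>
    (\<forall>a1 a2 b1 b2 c1 c2.
        (a1, a2) \<in> R \<longrightarrow> (b1, b2) \<in> R \<longrightarrow> (c1, c2) \<in> R \<longrightarrow>
        (a1, a2) \<noteq> (b1, b2) \<longrightarrow> (b1, b2) \<noteq> (c1, c2) \<longrightarrow> (a1, a2) \<noteq> (c1, c2) \<longrightarrow>
        a1 \<le> b1 \<longrightarrow> b1 \<le> c1 \<longrightarrow> a2 \<le> b2 \<longrightarrow> b2 \<le> c2 \<longrightarrow>
        ennreal (b2 - a2) / ennreal (b1 - a1) \<ge> ennreal (c2 - b2) / ennreal (c1 - b1))"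

end

theory Submission
  imports Defs
begin

text \<open>
  Both conditions amount to \<open>Q2 B * Q1 A \<le> Q2 A * Q1 B\<close> for intervals \<open>B\<close> to the left of \<open>A\<close>.
  Cross-multiplying the concavity inequality gives this for adjacent intervals, and if a
  monotone likelihood ratio exists it follows by integrating \<open>g2 y * g1 x \<le> g1 y * g2 x\<close>
  over \<open>y \<in> B\<close> and \<open>x \<in> A\<close>.  Conversely, put \<open>m = Q1 + Q2\<close> and let \<open>h x\<close> be the supremum of the
  ratios \<open>Q2 J / m J\<close> over the intervals \<open>J \<subseteq> {..x}\<close>.  Then \<open>h\<close> is non-decreasing, and on
  an interval where \<open>s \<le> h \<le> t\<close> the measure \<open>Q2\<close> lies between \<open>s * m\<close> and \<open>t * m\<close>.  Slicing
  \<open>{..u}\<close> by the values of \<open>h\<close>, which yields intervals again, shows that \<open>h\<close> is a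
  density of \<open>Q2\<close> and hence \<open>1 - h\<close> one of \<open>Q1\<close> with respect to \<open>m\<close>.
\<close>

section \<open>Exhausting a set of reals by initial or final sections\<close>

text \<open>A maximum of \<open>I\<close> gives a constant sequence. Otherwise a point of
  \<open>I\<close> is chosen above each rational that has one, and the running maxima over an
  enumeration of the rationals are cofinal, since between \<open>y\<close> and a larger point of
  \<open>I\<close> there is a rational. This spares a case distinction on the shape of an
  interval.\<close>

lemma ex_cofinal_incseq:
  fixes I :: "real set"
  assumes "I \<noteq> {}"
  obtains x :: "nat \<Rightarrow> real" where "incseq x" "range x \<subseteq> I" "\<And>y. y \<in> I \<Longrightarrow> \<exists>n. y \<le> x n"
proof (cases "\<exists>s\<in>I. \<forall>y\<in>I. y \<le> s")
  case True
  then obtain s where "s \<in> I" "\<forall>y\<in>I. y \<le> s" by blast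
  then show ?thesis using that[of "\<lambda>_. s"] by auto
next
  case False
  obtain i where i: "i \<in> I" using assms by blast
  \<comment> \<open>The default \<open>i\<close> keeps \<open>f q\<close> in \<open>I\<close> for
    rationals above all of \<open>I\<close>.\<close>
  define f where "f q = (if \<exists>s\<in>I. q \<le> s then SOME s. s \<in> I \<and> q \<le> s else i)" for q
  have f: "f q \<in> I" for q
    using i someI_ex[of "\<lambda>s. s \<in> I \<and> q \<le> s"] by (auto simp: f_def)
  have f_ge: "q \<le> f q" if "s \<in> I" "q \<le> s" for q s
    using that someI_ex[of "\<lambda>s. s \<in> I \<and> q \<le> s"] by (auto simp: f_def)
  define e where "e = from_nat_into (\<rat> :: real set)"
  have range_e: "range e = \<rat>"
    unfolding e_def using Rats_0 by (intro range_from_nat_into countable_rat) blast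
  define x where "x n = Max ((\<lambda>k. f (e k)) ` {..n})" for n
  show ?thesis
  proof
    show "incseq x"
      unfolding x_def by (intro incseq_SucI Max_mono) auto
    have "x n \<in> (\<lambda>k. f (e k)) ` {..n}" for n
      unfolding x_def by (intro Max_in) auto
    moreover have "(\<lambda>k. f (e k)) ` {..n} \<subseteq> I" for n
      by (intro image_subsetI f)
    ultimately show "range x \<subseteq> I" by (meson image_subsetI subsetD)
  next
    fix y assume "y \<in> I"
    with False obtain z where z: "z \<in> I" "y < z" by (meson not_le)
    obtain q where q: "q \<in> \<rat>" "y < q" "q < z" using Rats_dense_in_real z(2) by blast
    from q(1) range_e obtain n where n: "q = e n" by (metis imageE)
    have "q \<le> f q" using f_ge[OF z(1)] q(3) by simp
    also have "f q \<le> x n" unfolding x_def n by (intro Max_ge) auto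
    finally show "\<exists>n. y \<le> x n" using q(2) by (intro exI[of _ n]) simp
  qed
qed

text \<open>The sections \<open>I \<inter> {..x}\<close>, with \<open>x\<close> running through a
  cofinal sequence in \<open>I\<close>, increase to \<open>I\<close>; continuity from below carries
  the inequality to the limit.\<close>

lemma measure_le_if_initial:
  fixes I :: "real set"
  assumes "finite_borel_measure M" "finite_borel_measure N" and I: "I \<in> sets borel"
    and le: "\<And>x. x \<in> I \<Longrightarrow> c * measure M (I \<inter> {..x}) \<le> d * measure N (I \<inter> {..x})"
  shows "c * measure M I \<le> d * measure N I"
proof (cases "I = {}")
  case False
  interpret M: finite_borel_measure M by fact
  interpret N: finite_borel_measure N by fact
  obtain x :: "nat \<Rightarrow> real" where x: "incseq x" "range x \<subseteq> I" "\<And>y. y \<in> I \<Longrightarrow> \<exists>n. y \<le> x n"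
    using ex_cofinal_incseq[OF False] by blast
  let ?A = "\<lambda>n. I \<inter> {..x n}"
  have Un: "(\<Union>n. ?A n) = I" using x(3) by blast
  have A: "range ?A \<subseteq> sets borel" "incseq ?A"
    using I incseqD[OF x(1)] by (auto simp: incseq_def intro: order_trans)
  have "(\<lambda>n. c * measure M (?A n)) \<longlonglongrightarrow> c * measure M I"
    using M.finite_Lim_measure_incseq[of ?A] A Un by (intro tendsto_mult_left) auto
  moreover have "(\<lambda>n. d * measure N (?A n)) \<longlonglongrightarrow> d * measure N I"
    using N.finite_Lim_measure_incseq[of ?A] A Un by (intro tendsto_mult_left) auto
  ultimately show ?thesis
    using le x(2) by (intro LIMSEQ_le) blast+
qed simp

lemma measure_le_if_final:
  fixes I :: "real set"
  assumes "finite_borel_measure M" "finite_borel_measure N" and I: "I \<in> sets borel"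
    and le: "\<And>x. x \<in> I \<Longrightarrow> c * measure M (I \<inter> {x..}) \<le> d * measure N (I \<inter> {x..})"
  shows "c * measure M I \<le> d * measure N I"
proof (cases "I = {}")
  case False
  interpret M: finite_borel_measure M by fact
  interpret N: finite_borel_measure N by fact
  obtain x :: "nat \<Rightarrow> real" where x: "incseq x" "range x \<subseteq> uminus ` I"
      "\<And>y. y \<in> uminus ` I \<Longrightarrow> \<exists>n. y \<le> x n"
    using ex_cofinal_incseq[of "uminus ` I"] False by blast
  let ?A = "\<lambda>n. I \<inter> {- x n..}"
  have "\<exists>n. - x n \<le> y" if "y \<in> I" for y
    using x(3)[of "- y"] that by (auto simp: minus_le_iff)
  then have Un: "(\<Union>n. ?A n) = I" by auto
  have mem: "- x n \<in> I" for n using rangeI[of x n] x(2) by fastforce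
  have A: "range ?A \<subseteq> sets borel" "incseq ?A"
    using I incseqD[OF x(1)] by (auto simp: incseq_def intro: order_trans[rotated])
  have "(\<lambda>n. c * measure M (?A n)) \<longlonglongrightarrow> c * measure M I"
    using M.finite_Lim_measure_incseq[of ?A] A Un by (intro tendsto_mult_left) auto
  moreover have "(\<lambda>n. d * measure N (?A n)) \<longlonglongrightarrow> d * measure N I"
    using N.finite_Lim_measure_incseq[of ?A] A Un by (intro tendsto_mult_left) auto
  ultimately show ?thesis
    using le mem by (intro LIMSEQ_le) blast+
qed simp

section \<open>A monotone density from increasing ratios on intervals\<close>

text \<open>Intended for \<open>q = Q2\<close> and \<open>m = Q1 + Q2\<close>. Dividing by the
  dominating measure \<open>m\<close> instead of \<open>Q1\<close> keeps all ratios in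
  \<open>[0, 1]\<close>.\<close>

locale increasing_ratio = q: finite_borel_measure q + m: finite_borel_measure m
  for q m :: "real measure" +
  assumes le: "A \<in> sets borel \<Longrightarrow> measure q A \<le> measure m A"
    and cross: "\<lbrakk>is_interval B; is_interval A; \<And>y x. \<lbrakk>y \<in> B; x \<in> A\<rbrakk> \<Longrightarrow> y < x\<rbrakk>
      \<Longrightarrow> measure q B * measure m A \<le> measure q A * measure m B"
begin

lemma sets_interval [simp]:
  assumes "is_interval (I :: real set)"
  shows "I \<in> sets q" "I \<in> sets m"
  using real_interval_borel_measurable[OF assms] q.M_is_borel m.M_is_borel by (metis, metis)

text \<open>Both intervals may contain \<open>x\<close>: the ratio at the atom \<open>x\<close> lies between theirs.\<close>

lemma cross_at:
  assumes "is_interval J" "J \<subseteq> {..x}" and "is_interval K" "K \<subseteq> {x..}"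
  shows "measure q J * measure m K \<le> measure q K * measure m J"
proof (cases "x \<in> J \<and> x \<in> K")
  case False
  have "y < z" if "y \<in> J" "z \<in> K" for y z
  proof (rule ccontr)
    assume "\<not> y < z"
    moreover from that assms(2,4) have "y \<le> x" "x \<le> z" by auto
    ultimately have "y = x" "z = x" by linarith+
    with that False show False by blast
  qed
  then show ?thesis by (intro cross assms)
next
  case True
  define J0 where "J0 = J \<inter> {..<x}"
  define K0 where "K0 = K \<inter> {x<..}"
  have int: "is_interval J0" "is_interval K0" "is_interval {x}"
    using is_interval_cc[of x x]
    by (simp_all add: J0_def K0_def is_interval_Int assms is_interval_io is_interval_oi)
  have J: "J = J0 \<union> {x}" and K: "K = {x} \<union> K0"
    using True assms(2,4) by (auto simp: J0_def K0_def)
  have disj: "J0 \<inter> {x} = {}" "{x} \<inter> K0 = {}" by (auto simp: J0_def K0_def)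
  have eqs: "measure q J = measure q J0 + measure q {x}" "measure m J = measure m J0 + measure m {x}"
      "measure q K = measure q {x} + measure q K0" "measure m K = measure m {x} + measure m K0"
    unfolding J K
    by (intro q.finite_measure_Union m.finite_measure_Union sets_interval int disj)+
  \<comment> \<open>Expanding both products over the pieces leaves these three comparisons and the
    common term \<open>q {x} * m {x}\<close>.\<close>
  have "measure q J0 * measure m {x} \<le> measure q {x} * measure m J0"
    and "measure q J0 * measure m K0 \<le> measure q K0 * measure m J0"
    and "measure q {x} * measure m K0 \<le> measure q K0 * measure m {x}"
    by (intro cross int; simp add: J0_def K0_def)+
  then show ?thesis unfolding eqs by (simp add: algebra_simps)
qed

text \<open>
  Intervals with \<open>m J = 0\<close> contribute the ratio \<open>0\<close>, which \<open>J = {}\<close> contributes anyway.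
\<close>

definition h :: "real \<Rightarrow> real" where
  "h x = Sup {measure q J / measure m J | J. is_interval J \<and> J \<subseteq> {..x}}"

lemma ratio_le_1:
  assumes "is_interval J"
  shows "measure q J / measure m J \<le> 1"
  using le[OF real_interval_borel_measurable[OF assms]] by (auto simp: divide_le_eq_1 less_le)

lemma bdd_ratios: "bdd_above {measure q J / measure m J | J. is_interval J \<and> J \<subseteq> {..x}}"
  using ratio_le_1 by (intro bdd_aboveI[of _ 1]) auto

lemma ratio_le_h:
  assumes "is_interval J" "J \<subseteq> {..x}"
  shows "measure q J / measure m J \<le> h x"
  unfolding h_def using assms by (intro cSup_upper bdd_ratios) auto

lemma h_least:
  assumes "\<And>J. \<lbrakk>is_interval J; J \<subseteq> {..x}\<rbrakk> \<Longrightarrow> measure q J / measure m J \<le> t"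
  shows "h x \<le> t"
  unfolding h_def using assms is_interval_empty by (intro cSup_least) blast+

lemma h_nonneg: "0 \<le> h x"
  using ratio_le_h[of "{}" x] by simp

lemma h_le_1: "h x \<le> 1"
  by (intro h_least ratio_le_1)

lemma mono_h: "mono h"
  by (intro monoI h_least ratio_le_h) auto

lemma borel_measurable_h [measurable]: "h \<in> borel_measurable borel"
  by (rule borel_measurable_mono[OF mono_h])

lemma measure_le_h:
  assumes "is_interval J" "J \<subseteq> {..x}"
  shows "measure q J \<le> h x * measure m J"
proof (cases "measure m J = 0")
  case True
  then show ?thesis using le[OF real_interval_borel_measurable[OF assms(1)]] by simp
next
  case False
  then have "measure m J > 0" by (simp add: zero_less_measure_iff)
  then show ?thesis using ratio_le_h[OF assms] by (simp add: divide_le_eq)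
qed

text \<open>By \<open>cross_at\<close> the ratio on \<open>K\<close> bounds the ratio on every
  interval \<open>J \<subseteq> {..x}\<close>, hence their supremum \<open>h x\<close>.\<close>

lemma h_le_measure:
  assumes "is_interval K" "K \<subseteq> {x..}"
  shows "h x * measure m K \<le> measure q K"
proof (cases "measure m K = 0")
  case False
  then have pos: "measure m K > 0" by (simp add: zero_less_measure_iff)
  have "h x \<le> measure q K / measure m K"
  proof (rule h_least)
    fix J assume "is_interval J" "J \<subseteq> {..x}"
    from cross_at[OF this assms] pos show "measure q J / measure m J \<le> measure q K / measure m K"
      by (cases "measure m J = 0") (simp_all add: divide_le_eq le_divide_eq zero_less_measure_iff ac_simps)
  qed
  with pos show ?thesis by (simp add: le_divide_eq)
qed simp

text \<open>\<open>measure_le_h\<close> controls intervals up to a point \<open>x\<close>, but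
  \<open>I\<close> need not have a last point. So it is applied to the sections
  \<open>I \<inter> {..x}\<close> with \<open>x\<close> in \<open>I\<close>, which exhaust
  \<open>I\<close>.\<close>

lemma measure_le_if_h_le:
  assumes "is_interval I" and t: "\<And>x. x \<in> I \<Longrightarrow> h x \<le> t"
  shows "measure q I \<le> t * measure m I"
proof -
  have "1 * measure q I \<le> t * measure m I"
  proof (rule measure_le_if_initial)
    fix x assume x: "x \<in> I"
    have "measure q (I \<inter> {..x}) \<le> h x * measure m (I \<inter> {..x})"
      by (intro measure_le_h is_interval_Int assms(1) is_interval_ic) simp
    also have "\<dots> \<le> t * measure m (I \<inter> {..x})"
      using t[OF x] by (intro mult_right_mono) auto
    finally show "1 * measure q (I \<inter> {..x}) \<le> t * measure m (I \<inter> {..x})" by simp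
  qed (fact q.finite_borel_measure_axioms m.finite_borel_measure_axioms
      real_interval_borel_measurable[OF assms(1)])+
  then show ?thesis by simp
qed

lemma measure_ge_if_h_ge:
  assumes "is_interval I" and t: "\<And>x. x \<in> I \<Longrightarrow> t \<le> h x"
  shows "t * measure m I \<le> measure q I"
proof -
  have "t * measure m I \<le> 1 * measure q I"
  proof (rule measure_le_if_final)
    fix x assume x: "x \<in> I"
    have "t * measure m (I \<inter> {x..}) \<le> h x * measure m (I \<inter> {x..})"
      using t[OF x] by (intro mult_right_mono) auto
    also have "\<dots> \<le> measure q (I \<inter> {x..})"
      by (intro h_le_measure is_interval_Int assms(1) is_interval_ci) simp
    finally show "t * measure m (I \<inter> {x..}) \<le> 1 * measure q (I \<inter> {x..})" by simp
  qed (fact q.finite_borel_measure_axioms m.finite_borel_measure_axioms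
      real_interval_borel_measurable[OF assms(1)])+
  then show ?thesis by simp
qed

abbreviation "d \<equiv> density m (\<lambda>x. ennreal (h x))"

lemma measurable_m [measurable_cong]: "sets m = sets borel"
  by (rule m.M_is_borel)

lemma emeasure_d:
  assumes "P \<in> sets borel"
  shows "emeasure d P = (\<integral>\<^sup>+x. ennreal (h x) * indicator P x \<partial>m)"
  using assms by (intro emeasure_density) auto

lemma emeasure_d_le:
  assumes P: "P \<in> sets borel" and t: "\<And>x. x \<in> P \<Longrightarrow> h x \<le> t"
  shows "emeasure d P \<le> ennreal t * emeasure m P"
proof -
  have "emeasure d P \<le> (\<integral>\<^sup>+x. ennreal t * indicator P x \<partial>m)"
    unfolding emeasure_d[OF P]
    by (intro nn_integral_mono) (auto simp: t ennreal_leI split: split_indicator)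
  then show ?thesis using P by (simp add: nn_integral_cmult_indicator m.sets_M)
qed

lemma emeasure_d_ge:
  assumes P: "P \<in> sets borel" and t: "\<And>x. x \<in> P \<Longrightarrow> t \<le> h x"
  shows "ennreal t * emeasure m P \<le> emeasure d P"
proof -
  have "(\<integral>\<^sup>+x. ennreal t * indicator P x \<partial>m) \<le> emeasure d P"
    unfolding emeasure_d[OF P]
    by (intro nn_integral_mono) (auto simp: t ennreal_leI split: split_indicator)
  then show ?thesis using P by (simp add: nn_integral_cmult_indicator m.sets_M)
qed

lemma finite_borel_measure_d: "finite_borel_measure d"
proof -
  have "emeasure d UNIV \<le> ennreal 1 * emeasure m UNIV"
    by (intro emeasure_d_le h_le_1) auto
  also have "\<dots> < \<infinity>"
    by (simp add: m.emeasure_eq_measure)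
  finally have "emeasure d (space d) < \<infinity>"
    using sets_eq_imp_space_eq[OF m.M_is_borel] by simp
  then have "finite_measure d" by (intro finite_measureI) simp
  then show ?thesis
    using m.M_is_borel by (simp add: finite_borel_measure_def finite_borel_measure_axioms_def)
qed

sublocale d: finite_borel_measure d
  by (rule finite_borel_measure_d)

text \<open>Gives \<open>d\<close> the two-sided bounds that \<open>q\<close> satisfies on
  intervals, so that \<open>d\<close> and \<open>q\<close> can be compared slice by slice.\<close>

lemma measure_d_bounds:
  assumes P: "P \<in> sets borel" and "0 \<le> s" "0 \<le> t"
    and h: "\<And>x. x \<in> P \<Longrightarrow> s \<le> h x \<and> h x \<le> t"
  shows "s * measure m P \<le> measure d P" "measure d P \<le> t * measure m P"
proof -
  have "ennreal (s * measure m P) \<le> ennreal (measure d P)"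
    using emeasure_d_ge[OF P, of s] h \<open>0 \<le> s\<close>
    by (simp add: d.emeasure_eq_measure m.emeasure_eq_measure ennreal_mult)
  then show "s * measure m P \<le> measure d P" by simp
  have "ennreal (measure d P) \<le> ennreal (t * measure m P)"
    using emeasure_d_le[OF P, of t] h \<open>0 \<le> t\<close>
    by (simp add: d.emeasure_eq_measure m.emeasure_eq_measure ennreal_mult)
  then show "measure d P \<le> t * measure m P"
    using \<open>0 \<le> t\<close> by (simp add: ennreal_le_iff)
qed

text \<open>On the slice where \<open>h\<close> lies between \<open>k / n\<close> and
  \<open>(k + 1) / n\<close>, both \<open>q\<close> and \<open>d\<close> lie between these multiples
  of \<open>m\<close>. They differ there by at most \<open>m (P k) / n\<close>, and these errors add
  up to \<open>m I / n\<close>.\<close>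

lemma measure_interval_diff_le:
  assumes I: "is_interval I" and n: "n > (0::nat)"
  shows "\<bar>measure q I - measure d I\<bar> \<le> measure m I / n"
proof -
  \<comment> \<open>Half-open value ranges make the slices disjoint; monotonicity of
    \<open>h\<close> makes them intervals.\<close>
  define P where "P k = I \<inter> {x. real k \<le> n * h x \<and> n * h x < real k + 1}" for k
  have int: "is_interval (P k)" for k
    unfolding is_interval_1
  proof (intro ballI allI impI)
    fix a b x assume ab: "a \<in> P k" "b \<in> P k" "a \<le> x \<and> x \<le> b"
    then have "h a \<le> h x" "h x \<le> h b" using monoD[OF mono_h] by auto
    then have "n * h a \<le> n * h x" "n * h x \<le> n * h b" by (auto intro: mult_left_mono)
    moreover have "x \<in> I" using ab I unfolding is_interval_1 P_def by blast
    ultimately show "x \<in> P k" using ab by (auto simp: P_def)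
  qed
  then have sets: "P k \<in> sets borel" for k by (rule real_interval_borel_measurable)
  have disj: "disjoint_family_on P {..n}"
    unfolding disjoint_family_on_def P_def by auto
  \<comment> \<open>The index \<open>k = n\<close> catches the points with
    \<open>h x = 1\<close>.\<close>
  have Un: "(\<Union>k\<in>{..n}. P k) = I"
  proof (intro equalityI subsetI)
    fix x assume x: "x \<in> I"
    define k where "k = nat \<lfloor>n * h x\<rfloor>"
    have nn: "0 \<le> n * h x" using h_nonneg by simp
    then have k: "real k = of_int \<lfloor>n * h x\<rfloor>" by (simp add: k_def)
    have "n * h x \<le> n" using h_le_1[of x] n by (simp add: mult_left_le)
    then have "real k \<le> real n" using k by linarith
    moreover have "x \<in> P k" using x k by (simp add: P_def)
    ultimately show "x \<in> (\<Union>k\<in>{..n}. P k)" by auto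
  qed (auto simp: P_def)
  have piece: "\<bar>measure q (P k) - measure d (P k)\<bar> \<le> measure m (P k) / n" for k
  proof -
    have h: "real k / n \<le> h x \<and> h x \<le> (real k + 1) / n" if "x \<in> P k" for x
      using that n by (auto simp: P_def divide_simps mult.commute)
    have "real k / n * measure m (P k) \<le> measure q (P k)"
      and "measure q (P k) \<le> (real k + 1) / n * measure m (P k)"
      by (intro measure_ge_if_h_ge measure_le_if_h_le int; use h in blast)+
    moreover have "real k / n * measure m (P k) \<le> measure d (P k)"
      and "measure d (P k) \<le> (real k + 1) / n * measure m (P k)"
      using measure_d_bounds[OF sets _ _ h, of k] by simp_all
    moreover have "(real k + 1) / n * measure m (P k) - real k / n * measure m (P k)
        = measure m (P k) / n"
      by (simp add: field_simps add_divide_distrib)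
    ultimately show ?thesis by linarith
  qed
  have sum: "measure M I = (\<Sum>k\<le>n. measure M (P k))" if "finite_borel_measure M" for M
  proof -
    interpret M: finite_borel_measure M by fact
    show ?thesis
      unfolding Un[symmetric]
      using sets disj by (intro M.finite_measure_finite_Union) auto
  qed
  have "\<bar>measure q I - measure d I\<bar> = \<bar>\<Sum>k\<le>n. measure q (P k) - measure d (P k)\<bar>"
    by (simp add: sum sum_subtractf q.finite_borel_measure_axioms d.finite_borel_measure_axioms)
  also have "\<dots> \<le> (\<Sum>k\<le>n. \<bar>measure q (P k) - measure d (P k)\<bar>)"
    by (rule sum_abs)
  also have "\<dots> \<le> (\<Sum>k\<le>n. measure m (P k) / n)"
    by (intro sum_mono piece)
  also have "\<dots> = measure m I / n"
    by (simp add: sum m.finite_borel_measure_axioms sum_divide_distrib)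
  finally show ?thesis .
qed

text \<open>As the number of slices grows, the error bound on \<open>{..u}\<close> tends to
  \<open>0\<close>, so the distribution functions agree, and these determine a finite Borel
  measure.\<close>

lemma density_h: "d = q"
proof (rule cdf_unique')
  show "cdf d = cdf q"
  proof
    fix u
    have "(\<lambda>n. measure m {..u} / real (Suc n)) \<longlonglongrightarrow> 0"
      by real_asymp
    then have "\<bar>measure q {..u} - measure d {..u}\<bar> \<le> 0"
      by (rule LIMSEQ_le_const) (use measure_interval_diff_le[OF is_interval_ic] in blast)
    then show "cdf d u = cdf q u" by (simp add: cdf_def)
  qed
qed (rule d.finite_borel_measure_axioms q.finite_borel_measure_axioms)+

end

section \<open>Extended ratios and sums of measures\<close>

text \<open>Cross-multiplication survives zero denominators: for \<open>q = 0\<close> the left ratio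
  is infinite, and \<open>p * s \<le> 0\<close> with \<open>p > 0\<close> forces
  \<open>s = 0\<close>. The last two hypotheses exclude \<open>0 / 0\<close>.\<close>

lemma ennreal_divide_le_divide_iff:
  assumes "0 \<le> p" "0 \<le> q" "0 \<le> r" "0 \<le> s" "p + q > 0" "r + s > 0"
  shows "ennreal p / ennreal q \<le> ennreal r / ennreal s \<longleftrightarrow> p * s \<le> r * q"
proof -
  consider "q = 0" "s = 0" | "q = 0" "s > 0" | "q > 0" "s = 0" | "q > 0" "s > 0"
    using assms by linarith
  then show ?thesis
  proof cases
    case 1
    then show ?thesis using assms by simp
  next
    case 2
    then show ?thesis using assms by (simp add: divide_ennreal mult_le_0_iff top_unique)
  next
    case 3
    then show ?thesis using assms by simp
  next
    case 4
    then show ?thesis using assms by (simp add: divide_ennreal frac_le_eq ennreal_le_iff pos_divide_le_eq pos_le_divide_eq ac_simps)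
  qed
qed

definition add_measure :: "real measure \<Rightarrow> real measure \<Rightarrow> real measure" where
  "add_measure M N = measure_of UNIV (sets borel) (\<lambda>A. emeasure M A + emeasure N A)"

lemma sets_add_measure [simp, measurable_cong]: "sets (add_measure M N) = sets borel"
  unfolding add_measure_def using sets.sigma_sets_eq[of "borel :: real measure"] by simp

lemma emeasure_add_measure:
  assumes "sets M = sets borel" "sets N = sets borel" "A \<in> sets borel"
  shows "emeasure (add_measure M N) A = emeasure M A + emeasure N A"
proof (rule emeasure_measure_of[OF add_measure_def])
  show "countably_additive (sets (add_measure M N)) (\<lambda>A. emeasure M A + emeasure N A)"
  proof (rule countably_additiveI)
    fix A :: "nat \<Rightarrow> real set"
    assume "range A \<subseteq> sets (add_measure M N)" "disjoint_family A"
    then show "(\<Sum>i. emeasure M (A i) + emeasure N (A i)) = emeasure M (\<Union>i. A i) + emeasure N (\<Union>i. A i)"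
      using assms(1,2) by (simp add: suminf_add[symmetric] suminf_emeasure)
  qed
qed (use assms in \<open>auto simp: positive_def\<close>)

lemma finite_borel_measure_add_measure:
  assumes "finite_borel_measure M" "finite_borel_measure N"
  shows "finite_borel_measure (add_measure M N)"
proof -
  interpret M: finite_borel_measure M by fact
  interpret N: finite_borel_measure N by fact
  have "emeasure (add_measure M N) (space (add_measure M N)) \<noteq> \<infinity>"
    using sets_eq_imp_space_eq[OF sets_add_measure[of M N]]
    by (simp add: emeasure_add_measure M.M_is_borel N.M_is_borel)
  then show ?thesis
    by (simp add: finite_borel_measure_def finite_borel_measure_axioms_def finite_measureI)
qed

lemma measure_add_measure:
  assumes "finite_borel_measure M" "finite_borel_measure N" "A \<in> sets borel"
  shows "measure (add_measure M N) A = measure M A + measure N A"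
proof -
  interpret M: finite_borel_measure M by fact
  interpret N: finite_borel_measure N by fact
  show ?thesis
    using assms(3) by (simp add: measure_def emeasure_add_measure M.M_is_borel N.M_is_borel
        enn2real_plus less_top[symmetric])
qed

section \<open>Likelihood ratio order and cross products of measures\<close>

text \<open>With respect to \<open>m = Q1 + Q2\<close>, the measure \<open>Q2\<close> has the
  monotone density \<open>h\<close>; subtracting from \<open>m\<close> leaves \<open>1 - h\<close>
  for \<open>Q1\<close>. The ratio \<open>h / (1 - h)\<close> increases with
  \<open>h\<close>.\<close>

lemma lr_le_if_cross:
  assumes "finite_borel_measure Q1" "finite_borel_measure Q2"
    and cross: "\<And>A B. \<lbrakk>is_interval B; is_interval A; \<And>y x. \<lbrakk>y \<in> B; x \<in> A\<rbrakk> \<Longrightarrow> y < x\<rbrakk>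
      \<Longrightarrow> measure Q2 B * measure Q1 A \<le> measure Q2 A * measure Q1 B"
  shows "Q1 \<le>\<^sub>l\<^sub>r Q2"
proof -
  interpret Q1: finite_borel_measure Q1 by fact
  interpret Q2: finite_borel_measure Q2 by fact
  define m where "m = add_measure Q1 Q2"
  interpret m: finite_borel_measure m
    unfolding m_def by (intro finite_borel_measure_add_measure assms)
  have m_eq: "measure m A = measure Q1 A + measure Q2 A" if "A \<in> sets borel" for A
    unfolding m_def by (intro measure_add_measure assms that)
  interpret increasing_ratio Q2 m
  proof
    show "measure Q2 A \<le> measure m A" if "A \<in> sets borel" for A
      using m_eq[OF that] by simp
    \<comment> \<open>This is \<open>cross\<close> with \<open>Q2 B * Q2 A\<close> added to both
      sides.\<close>
    show "measure Q2 B * measure m A \<le> measure Q2 A * measure m B"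
      if "is_interval B" "is_interval A" "\<And>y x. \<lbrakk>y \<in> B; x \<in> A\<rbrakk> \<Longrightarrow> y < x" for A B
      using cross[OF that] that(1,2)
      by (simp add: m_eq real_interval_borel_measurable algebra_simps)
  qed
  have "Q1 = density m (\<lambda>x. ennreal (1 - h x))"
  proof (rule measure_eqI)
    fix A assume "A \<in> sets Q1"
    then have A [measurable]: "A \<in> sets borel" by (simp add: Q1.M_is_borel)
    have "emeasure Q1 A + emeasure Q2 A = emeasure m A"
      unfolding m_def by (simp add: emeasure_add_measure Q1.M_is_borel Q2.M_is_borel A)
    also have "\<dots> = (\<integral>\<^sup>+x. indicator A x \<partial>m)"
      using A by (simp add: m.sets_M)
    also have "\<dots> = (\<integral>\<^sup>+x. ennreal (1 - h x) * indicator A x + ennreal (h x) * indicator A x \<partial>m)"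
      using h_nonneg h_le_1
      by (intro nn_integral_cong) (auto split: split_indicator simp flip: ennreal_plus)
    also have "\<dots> = emeasure (density m (\<lambda>x. ennreal (1 - h x))) A + emeasure d A"
      by (subst nn_integral_add) (auto simp: emeasure_density)
    finally show "emeasure Q1 A = emeasure (density m (\<lambda>x. ennreal (1 - h x))) A"
      by (simp add: density_h Q2.emeasure_eq_measure ennreal_add_left_cancel
          add.commute[of _ "ennreal (measure Q2 A)"])
  qed (simp add: Q1.M_is_borel m.M_is_borel)
  moreover have "mono_on {x. (1 - h x) + h x > 0} (\<lambda>x. ennreal (h x) / ennreal (1 - h x))"
  proof (rule mono_onI)
    fix x y :: real assume "x \<le> y"
    \<comment> \<open>The products \<open>h x * h y\<close> cancel, leaving
      \<open>h x \<le> h y\<close>.\<close>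
    then have "h x * (1 - h y) \<le> h y * (1 - h x)"
      using monoD[OF mono_h] by (simp add: algebra_simps)
    then show "ennreal (h x) / ennreal (1 - h x) \<le> ennreal (h y) / ennreal (1 - h y)"
      by (subst ennreal_divide_le_divide_iff) (auto simp: h_nonneg h_le_1)
  qed
  ultimately show ?thesis
    unfolding lr_le_def using h_nonneg h_le_1 m.sigma_finite_measure_axioms m.M_is_borel density_h
    by (intro exI[of _ m] exI[of _ "\<lambda>x. 1 - h x"] exI[of _ h]) auto
qed

lemma lr_le_imp_cross:
  assumes "Q1 \<le>\<^sub>l\<^sub>r Q2" "finite_measure Q1" "finite_measure Q2"
    and [measurable]: "A \<in> sets borel" "B \<in> sets borel"
    and less: "\<And>y x. \<lbrakk>y \<in> B; x \<in> A\<rbrakk> \<Longrightarrow> y < x"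
  shows "measure Q2 B * measure Q1 A \<le> measure Q2 A * measure Q1 B"
proof -
  interpret Q1: finite_measure Q1 by fact
  interpret Q2: finite_measure Q2 by fact
  obtain m g1 g2 where [measurable_cong]: "sets m = sets borel"
    and [measurable]: "g1 \<in> borel_measurable borel" "g2 \<in> borel_measurable borel"
    and nonneg: "\<And>x. 0 \<le> g1 x" "\<And>x. 0 \<le> g2 x"
    and Q1: "Q1 = density m (\<lambda>x. ennreal (g1 x))" and Q2: "Q2 = density m (\<lambda>x. ennreal (g2 x))"
    and mono: "mono_on {x. g1 x + g2 x > 0} (\<lambda>x. ennreal (g2 x) / ennreal (g1 x))"
    using assms(1) unfolding lr_le_def by blast
  \<comment> \<open>Where both densities vanish at \<open>x\<close> or at \<open>y\<close>, both
    sides are \<open>0\<close>; hence the inequality holds for all \<open>y \<le> x\<close>, not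
    only on the domain of \<open>mono\<close>.\<close>
  have le: "g2 y * g1 x \<le> g1 y * g2 x" if "y \<le> x" for x y
  proof (cases "g1 x + g2 x > 0 \<and> g1 y + g2 y > 0")
    case True
    then have "ennreal (g2 y) / ennreal (g1 y) \<le> ennreal (g2 x) / ennreal (g1 x)"
      using that by (intro mono_onD[OF mono]) auto
    then show ?thesis
      using True nonneg by (subst (asm) ennreal_divide_le_divide_iff) (auto simp: ac_simps)
  next
    case False
    then have "g1 x = 0 \<and> g2 x = 0 \<or> g1 y = 0 \<and> g2 y = 0"
      using nonneg by (smt (verit))
    then show ?thesis by auto
  qed
  \<comment> \<open>The order of integration is the same for both products, so Fubini's theorem is not needed.\<close>
  have prod_eq: "emeasure (density m (\<lambda>x. ennreal (f x))) B * emeasure (density m (\<lambda>x. ennreal (g x))) A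
      = (\<integral>\<^sup>+y. \<integral>\<^sup>+x. (ennreal (f y) * indicator B y) * (ennreal (g x) * indicator A x) \<partial>m \<partial>m)"
    if [measurable]: "f \<in> borel_measurable borel" "g \<in> borel_measurable borel" for f g :: "real \<Rightarrow> real"
    by (simp add: emeasure_density nn_integral_cmult nn_integral_multc)
  have "emeasure Q2 B * emeasure Q1 A
      = (\<integral>\<^sup>+y. \<integral>\<^sup>+x. (ennreal (g2 y) * indicator B y) * (ennreal (g1 x) * indicator A x) \<partial>m \<partial>m)"
    unfolding Q1 Q2 by (rule prod_eq) measurable
  also have "\<dots> \<le> (\<integral>\<^sup>+y. \<integral>\<^sup>+x. (ennreal (g1 y) * indicator B y) * (ennreal (g2 x) * indicator A x) \<partial>m \<partial>m)"
  proof (intro nn_integral_mono)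
    fix y x
    show "(ennreal (g2 y) * indicator B y) * (ennreal (g1 x) * indicator A x)
      \<le> (ennreal (g1 y) * indicator B y) * (ennreal (g2 x) * indicator A x)"
    proof (cases "y \<in> B \<and> x \<in> A")
      case True
      then have "g2 y * g1 x \<le> g1 y * g2 x" using less by (intro le less_imp_le) auto
      with True show ?thesis using nonneg by (simp add: ennreal_leI flip: ennreal_mult)
    qed auto
  qed
  also have "\<dots> = emeasure Q1 B * emeasure Q2 A"
    unfolding Q1 Q2 by (rule prod_eq[symmetric]) measurable
  finally have "ennreal (measure Q2 B * measure Q1 A) \<le> ennreal (measure Q1 B * measure Q2 A)"
    by (simp add: Q1.emeasure_eq_measure Q2.emeasure_eq_measure flip: ennreal_mult)
  then show ?thesis by (simp add: mult.commute)
qed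

section \<open>Upper half-lines and the intervals between them\<close>

text \<open>A nonempty proper upward closed set lies between the open and the closed half-line at
  its infimum, and these differ in one point. Upward closedness then replaces any case distinction
  on the form of a half-line.\<close>

lemma upper_halflines_iff: "H \<in> upper_halflines \<longleftrightarrow> (\<forall>x\<in>H. \<forall>y\<ge>x. y \<in> H)"
proof
  assume up: "\<forall>x\<in>H. \<forall>y\<ge>x. y \<in> H"
  show "H \<in> upper_halflines"
  proof (cases "H = {} \<or> H = UNIV")
    case False
    then obtain z where "z \<notin> H" by blast
    with up have bdd: "bdd_below H" by (intro bdd_belowI[of _ z]) (meson linear)
    have "{Inf H<..} \<subseteq> H"
    proof
      fix x assume "x \<in> {Inf H<..}"
      then obtain w where "w \<in> H" "w < x"
        using False cInf_less_iff[OF _ bdd] by auto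
      with up show "x \<in> H" by auto
    qed
    moreover have "H \<subseteq> {Inf H..}" using cInf_lower[OF _ bdd] by auto
    moreover have "{Inf H..} = insert (Inf H) {Inf H<..}" by auto
    ultimately have "H = {Inf H..} \<or> H = {Inf H<..}"
      by (metis insert_subset subset_antisym subset_insert)
    then show ?thesis unfolding upper_halflines_def by blast
  qed (auto simp: upper_halflines_def)
qed (auto simp: upper_halflines_def)

lemma upper_halflines_linear:
  assumes "H \<in> upper_halflines" "K \<in> upper_halflines"
  shows "H \<subseteq> K \<or> K \<subseteq> H"
  using assms unfolding upper_halflines_iff by (meson linear subsetI)

lemma upper_halflines_borel:
  assumes "H \<in> upper_halflines"
  shows "H \<in> sets borel"
  using assms unfolding upper_halflines_def by auto

text \<open>Transitivity of comparing the ratios \<open>a2 / a1\<close>, \<open>b2 / b1\<close>,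
  \<open>c2 / c1\<close>. If \<open>b1 = b2 = 0\<close>, the first two comparisons are void; the
  third, with \<open>a + b\<close> in place of \<open>a\<close>, then gives the claim.\<close>

lemma cross_trans:
  fixes a1 a2 b1 b2 c1 c2 :: real
  assumes "0 \<le> a1" "0 \<le> a2" "0 \<le> b1" "0 \<le> b2" "0 \<le> c1" "0 \<le> c2"
    and "b2 * a1 \<le> a2 * b1" "c2 * b1 \<le> b2 * c1" "c2 * (a1 + b1) \<le> (a2 + b2) * c1"
  shows "c2 * a1 \<le> a2 * c1"
proof -
  consider "b1 = 0" "b2 = 0" | "b1 = 0" "b2 > 0" | "b1 > 0" "b2 = 0" | "b1 > 0" "b2 > 0"
    using assms by linarith
  then show ?thesis
  proof cases
    case 2
    with assms have "a1 = 0" by (simp add: mult_le_0_iff)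
    with assms show ?thesis by simp
  next
    case 3
    with assms have "c2 = 0" by (simp add: mult_le_0_iff)
    with assms show ?thesis by simp
  next
    case 4
    \<comment> \<open>The two comparisons are multiplied and the positive factor
      \<open>b1 * b2\<close> is cancelled.\<close>
    have "(c2 * b1) * (b2 * a1) \<le> (b2 * c1) * (a2 * b1)"
      using assms by (intro mult_mono[OF assms(8,7)]) auto
    then have "(c2 * a1) * (b1 * b2) \<le> (a2 * c1) * (b1 * b2)" by (simp add: ac_simps)
    with 4 show ?thesis by simp
  qed (use assms in simp)
qed

text \<open>Nested half-lines cut out adjacent intervals only, whereas \<open>B\<close> and
  \<open>A\<close> may have a gap \<open>?M\<close> between them. The pairs \<open>?M\<close>,
  \<open>A\<close> and \<open>B\<close>, \<open>?M\<close> are adjacent, and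
  \<open>cross_trans\<close> passes across the gap; since the gap may be null for both measures, the
  pair \<open>B\<close>, \<open>A \<union> ?M\<close> is used as well.\<close>

lemma interval_cross_if_nested:
  assumes "finite_borel_measure Q1" "finite_borel_measure Q2"
    and nested: "\<And>U V W. \<lbrakk>U \<in> upper_halflines; V \<in> upper_halflines; W \<in> upper_halflines; U \<subseteq> V; V \<subseteq> W\<rbrakk>
      \<Longrightarrow> measure Q2 (W - V) * measure Q1 (V - U) \<le> measure Q2 (V - U) * measure Q1 (W - V)"
    and A: "is_interval A" and B: "is_interval B" and less: "\<And>y x. \<lbrakk>y \<in> B; x \<in> A\<rbrakk> \<Longrightarrow> y < x"
  shows "measure Q2 B * measure Q1 A \<le> measure Q2 A * measure Q1 B"
proof (cases "A = {} \<or> B = {}")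
  case False
  interpret Q1: finite_borel_measure Q1 by fact
  interpret Q2: finite_borel_measure Q2 by fact
  \<comment> \<open>\<open>up S\<close> is the least upper half-line containing \<open>S\<close>,
    and removing \<open>above S\<close> from it leaves \<open>S\<close> if \<open>S\<close> is an
    interval. This works whichever endpoints belong to \<open>S\<close>.\<close>
  define up where "up S = {x::real. \<exists>y\<in>S. y \<le> x}" for S
  define above where "above S = {x::real. \<forall>y\<in>S. y < x}" for S
  have upper: "up S \<in> upper_halflines" "above S \<in> upper_halflines" for S
    unfolding upper_halflines_iff up_def above_def by (auto intro: order_trans less_le_trans)
  have sub: "above A \<subseteq> up A" "up A \<subseteq> above B" "above B \<subseteq> up B"
    using False less unfolding up_def above_def by (blast intro: less_imp_le less_le_trans)+
  have diff: "up S - above S = S" if "is_interval S" for S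
  proof (intro equalityI subsetI)
    fix x assume "x \<in> up S - above S"
    then obtain y z where "y \<in> S" "z \<in> S" "y \<le> x" "x \<le> z"
      unfolding up_def above_def by (auto simp: not_less)
    with that show "x \<in> S" unfolding is_interval_1 by blast
  qed (auto simp: up_def above_def)
  let ?M = "above B - up A"
  have AM: "above B - above A = A \<union> ?M"
    using diff[OF A] sub by blast
  have sets: "A \<in> sets borel" "?M \<in> sets borel" "A \<inter> ?M = {}"
    using A upper by (auto simp: real_interval_borel_measurable upper_halflines_borel up_def)
  have "measure Q2 ?M * measure Q1 A \<le> measure Q2 A * measure Q1 ?M"
    using nested[OF upper(2,1,2) sub(1,2)] diff[OF A] by simp
  moreover have "measure Q2 B * measure Q1 ?M \<le> measure Q2 ?M * measure Q1 B"
    using nested[OF upper(1,2,1) sub(2,3)] diff[OF B] by simp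
  moreover have "measure Q2 B * measure Q1 (A \<union> ?M) \<le> measure Q2 (A \<union> ?M) * measure Q1 B"
    using nested[OF upper(2,2,1) subset_trans[OF sub(1,2)] sub(3)] diff[OF B] AM by simp
  moreover have "measure Q1 (A \<union> ?M) = measure Q1 A + measure Q1 ?M"
    by (intro Q1.finite_measure_Union Q1.sets_M sets)
  moreover have "measure Q2 (A \<union> ?M) = measure Q2 A + measure Q2 ?M"
    by (intro Q2.finite_measure_Union Q2.sets_M sets)
  ultimately show ?thesis
    by (metis cross_trans measure_nonneg)
qed auto

section \<open>Concavity of the ROC curve in terms of nested half-lines\<close>

text \<open>Increments between points of the curve are measures of differences of half-lines, so
  cross-multiplying the slopes gives the products on the right.\<close>

lemma ROC_concave_iff_nested:
  assumes "finite_borel_measure Q1" "finite_borel_measure Q2"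
  shows "ROC_concave (ROC Q1 Q2) \<longleftrightarrow>
    (\<forall>U\<in>upper_halflines. \<forall>V\<in>upper_halflines. \<forall>W\<in>upper_halflines. U \<subseteq> V \<longrightarrow> V \<subseteq> W \<longrightarrow>
      measure Q2 (W - V) * measure Q1 (V - U) \<le> measure Q2 (V - U) * measure Q1 (W - V))"
    (is "?L \<longleftrightarrow> ?R")
proof -
  interpret Q1: finite_borel_measure Q1 by fact
  interpret Q2: finite_borel_measure Q2 by fact
  have mono: "measure Q1 U \<le> measure Q1 V" "measure Q2 U \<le> measure Q2 V"
    if "U \<subseteq> V" "V \<in> upper_halflines" for U V
    using that upper_halflines_borel
    by (auto intro!: Q1.finite_measure_mono Q2.finite_measure_mono)
  have diff: "measure Q1 (V - U) = measure Q1 V - measure Q1 U"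
    "measure Q2 (V - U) = measure Q2 V - measure Q2 U"
    if "U \<subseteq> V" "U \<in> upper_halflines" "V \<in> upper_halflines" for U V
    using that upper_halflines_borel
    by (auto intro!: Q1.finite_measure_Diff Q2.finite_measure_Diff)
  show ?thesis
  proof
    assume L: ?L
    show ?R
    proof (intro ballI impI)
      fix U V W assume uh: "U \<in> upper_halflines" "V \<in> upper_halflines" "W \<in> upper_halflines"
        and sub: "U \<subseteq> V" "V \<subseteq> W"
      note les = mono[OF sub(1) uh(2)] mono[OF sub(2) uh(3)]
      let ?p = "\<lambda>H. (measure Q1 H, measure Q2 H)"
      have in_ROC: "?p U \<in> ROC Q1 Q2" "?p V \<in> ROC Q1 Q2" "?p W \<in> ROC Q1 Q2"
        using uh unfolding ROC_def by blast+
      show "measure Q2 (W - V) * measure Q1 (V - U) \<le> measure Q2 (V - U) * measure Q1 (W - V)"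
      \<comment> \<open>Concavity concerns three different points only. If neighbouring points
        coincide, both products are \<open>0\<close>; otherwise monotonicity also separates the
        outer two.\<close>
      proof (cases "?p U = ?p V \<or> ?p V = ?p W")
        case True
        then show ?thesis using uh sub by (auto simp: diff)
      next
        case False
        with les have ne: "?p U \<noteq> ?p W" by auto
        have "ennreal (measure Q2 W - measure Q2 V) / ennreal (measure Q1 W - measure Q1 V)
          \<le> ennreal (measure Q2 V - measure Q2 U) / ennreal (measure Q1 V - measure Q1 U)"
          using L[unfolded ROC_concave_def, rule_format, OF in_ROC] False ne les by blast
        then show ?thesis
          using False les uh sub
          by (subst (asm) ennreal_divide_le_divide_iff) (auto simp: diff)
      qed
    qed
  next
    assume R: ?R
    \<comment> \<open>Half-lines are comparable by inclusion. If \<open>K \<subseteq> H\<close>,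
      monotonicity would make the two points equal, so the order of the points is that of the
      sets.\<close>
    have sub: "H \<subseteq> K" if "H \<in> upper_halflines" "K \<in> upper_halflines"
      "measure Q1 H \<le> measure Q1 K" "measure Q2 H \<le> measure Q2 K"
      "(measure Q1 H, measure Q2 H) \<noteq> (measure Q1 K, measure Q2 K)" for H K
      using upper_halflines_linear[OF that(1,2)] mono[of K H] that by force
    show ?L
      unfolding ROC_concave_def
    proof (intro allI impI)
      fix a1 a2 b1 b2 c1 c2
      assume mem: "(a1, a2) \<in> ROC Q1 Q2" "(b1, b2) \<in> ROC Q1 Q2" "(c1, c2) \<in> ROC Q1 Q2"
        and ne: "(a1, a2) \<noteq> (b1, b2)" "(b1, b2) \<noteq> (c1, c2)"
        and le: "a1 \<le> b1" "b1 \<le> c1" "a2 \<le> b2" "b2 \<le> c2"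
      obtain U V W where uh: "U \<in> upper_halflines" "V \<in> upper_halflines" "W \<in> upper_halflines"
        and eqs: "a1 = measure Q1 U" "a2 = measure Q2 U" "b1 = measure Q1 V" "b2 = measure Q2 V"
          "c1 = measure Q1 W" "c2 = measure Q2 W"
        using mem unfolding ROC_def by auto
      have sub': "U \<subseteq> V" "V \<subseteq> W"
        using sub uh ne le unfolding eqs by blast+
      have "(c2 - b2) * (b1 - a1) \<le> (b2 - a2) * (c1 - b1)"
        using R uh sub' by (auto simp: diff eqs)
      then show "ennreal (c2 - b2) / ennreal (c1 - b1) \<le> ennreal (b2 - a2) / ennreal (b1 - a1)"
        using ne le by (subst ennreal_divide_le_divide_iff) auto
    qed
  qed
qed

theorem corollary7:
  fixes Q1 Q2 :: "real measure"
  assumes "real_distribution Q1" and "real_distribution Q2"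
  shows "Q1 \<le>\<^sub>l\<^sub>r Q2 \<longleftrightarrow> ROC_concave (ROC Q1 Q2)"
proof -
  interpret Q1: real_distribution Q1 by fact
  interpret Q2: real_distribution Q2 by fact
  note fin = Q1.finite_borel_measure_axioms Q2.finite_borel_measure_axioms
  show ?thesis
    unfolding ROC_concave_iff_nested[OF fin]
  proof (intro iffI ballI impI)
    fix U V W assume lr: "Q1 \<le>\<^sub>l\<^sub>r Q2"
      and uh: "U \<in> upper_halflines" "V \<in> upper_halflines" "W \<in> upper_halflines"
    \<comment> \<open>\<open>V\<close> is upward closed, so a point outside \<open>V\<close> lies
      below every point of \<open>V\<close>: the difference \<open>W - V\<close> is the left
      set.\<close>
    have "y < x" if "y \<in> W - V" "x \<in> V - U" for x y
    proof (rule ccontr)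
      assume "\<not> y < x"
      then have "x \<le> y" by simp
      with that uh(2) show False unfolding upper_halflines_iff by blast
    qed
    then show "measure Q2 (W - V) * measure Q1 (V - U) \<le> measure Q2 (V - U) * measure Q1 (W - V)"
      by (intro lr_le_imp_cross[OF lr] Q1.finite_measure_axioms Q2.finite_measure_axioms
          sets.Diff upper_halflines_borel uh)
  next
    assume nested: "\<forall>U\<in>upper_halflines. \<forall>V\<in>upper_halflines. \<forall>W\<in>upper_halflines. U \<subseteq> V \<longrightarrow> V \<subseteq> W \<longrightarrow>
      measure Q2 (W - V) * measure Q1 (V - U) \<le> measure Q2 (V - U) * measure Q1 (W - V)"
    show "Q1 \<le>\<^sub>l\<^sub>r Q2"
    proof (rule lr_le_if_cross[OF fin])
      fix A B :: "real set"
      assume "is_interval B" "is_interval A" and "\<And>y x. \<lbrakk>y \<in> B; x \<in> A\<rbrakk> \<Longrightarrow> y < x"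
      then show "measure Q2 B * measure Q1 A \<le> measure Q2 A * measure Q1 B"
        using interval_cross_if_nested[OF fin nested[rule_format], of A B] by presburger
    qed
  qed
qed

end
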